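(* Let $(\alpha,\beta)$ be a random vector in $\mathbb{R}^2$ such that (i) $\mathbb{P}(\alpha\neq 0)=1$; (ii) $\mathbb{P}(|\alpha|\neq 1)>0$; (iii) for every $c\in\mathbb{R}$, $\mathbb{P}(\alpha(c-\beta)=c)<1$. Assume that $$0<\mathbb{E}\{\ln|\alpha|\}<\infty,\qquad \mathbb{E}\{\ln\max(|\beta|,1)\}<\infty,$$ and also that $\alpha>0$ almost surely. Let $F_\Upsilon$ be the distribution function of the random series $\Upsilon$ associated with $(\alpha,\beta)$ (defined in the context). Then $y=F_\Upsilon(x)$ is a bounded continuous solution of the equation $$y(x)=\mathbb{E}\{y(\alpha(x-\beta))\},\qquad x\in\mathbb{R}.$$
   Context: Let $(\alpha_n,\beta_n)_{n\ge1}$ be independent random pairs, each with the same distribution as $(\alpha,\beta)$. Put $A_0:=1$ and $A_n:=\prod_{i=1}^n\alpha_i$ for $n\ge1$. The random series $\Upsilon$ is $$\Upsilon:=\sum_{n=1}^\infty \beta_n A_{n-1}^{-1}=\beta_1+\beta_2\alpha_1^{-1}+\beta_3\alpha_1^{-1}\alpha_2^{-1}+\cdots,$$ which converges almost surely under the stated assumptions, and $F_\Upsilon(x):=\mathbb{P}(\Upsilon\le x)$, $x\in\mathbb{R}$. The variables $\alpha$ and $\beta$ need not be independent of each other. *)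

theory Defs
  imports "HOL-Probability.Probability"
begin

text \<open>
  The sequences of random variables are used at the indices \<open>1, 2, 3, \<dots>\<close>; their values at index
  \<open>0\<close> are irrelevant.
\<close>

definition A_prod :: "(nat \<Rightarrow> 'a \<Rightarrow> real) \<Rightarrow> nat \<Rightarrow> 'a \<Rightarrow> real" where
  "A_prod \<alpha>s n \<omega> = (\<Prod>i=1..n. \<alpha>s i \<omega>)"

text \<open>
  The index is shifted by one: the summand at \<open>n\<close> is the term of the series with number \<open>n + 1\<close>.
  Where the series diverges, \<^const>\<open>suminf\<close> has an unspecified value; almost sure
  convergence is a consequence of the moment assumptions, so this concerns a null set only.
\<close>

definition Upsilon :: "(nat \<Rightarrow> 'a \<Rightarrow> real) \<Rightarrow> (nat \<Rightarrow> 'a \<Rightarrow> real) \<Rightarrow> 'a \<Rightarrow> real" where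
  "Upsilon \<alpha>s \<beta>s \<omega> = (\<Sum>n. \<beta>s (Suc n) \<omega> * inverse (A_prod \<alpha>s n \<omega>))"

definition F_Upsilon ::
    "'a measure \<Rightarrow> (nat \<Rightarrow> 'a \<Rightarrow> real) \<Rightarrow> (nat \<Rightarrow> 'a \<Rightarrow> real) \<Rightarrow> real \<Rightarrow> real" where
  "F_Upsilon N \<alpha>s \<beta>s x = \<P>(\<omega> in N. Upsilon \<alpha>s \<beta>s \<omega> \<le> x)"

definition iid_copies ::
    "'a measure \<Rightarrow> ('a \<Rightarrow> real) \<Rightarrow> ('a \<Rightarrow> real) \<Rightarrow>
     'b measure \<Rightarrow> (nat \<Rightarrow> 'b \<Rightarrow> real) \<Rightarrow> (nat \<Rightarrow> 'b \<Rightarrow> real) \<Rightarrow> bool" where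
  "iid_copies M \<alpha> \<beta> N \<alpha>s \<beta>s \<longleftrightarrow>
     prob_space.indep_vars N (\<lambda>_. borel) (\<lambda>n \<omega>. (\<alpha>s n \<omega>, \<beta>s n \<omega>)) {1..} \<and>
     (\<forall>n\<ge>1. distr N borel (\<lambda>\<omega>. (\<alpha>s n \<omega>, \<beta>s n \<omega>)) = distr M borel (\<lambda>\<omega>. (\<alpha> \<omega>, \<beta> \<omega>)))"

text \<open>
  Integrability is required explicitly, because the Bochner integral of a non-integrable function
  is \<open>0\<close> by convention.
\<close>

definition solves_equation ::
    "'a measure \<Rightarrow> ('a \<Rightarrow> real) \<Rightarrow> ('a \<Rightarrow> real) \<Rightarrow> (real \<Rightarrow> real) \<Rightarrow> bool" where
  "solves_equation M \<alpha> \<beta> y \<longleftrightarrow>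
     (\<forall>x. integrable M (\<lambda>\<omega>. y (\<alpha> \<omega> * (x - \<beta> \<omega>))) \<and>
          y x = (LINT \<omega>|M. y (\<alpha> \<omega> * (x - \<beta> \<omega>))))"

end

theory Submission
  imports Defs
begin

text \<open>
  The law of the i.i.d. sequence of pairs is invariant under prepending an independent pair
  \<open>(a, b)\<close>, and this turns the series \<open>\<Upsilon>\<close> into \<open>b + \<Upsilon> / a\<close>. Since \<open>a > 0\<close>, the event
  \<open>b + \<Upsilon> / a \<le> x\<close> is \<open>\<Upsilon> \<le> a (x - b)\<close>, which gives the functional equation. Almost sure
  convergence needs only a one-sided form of the law of large numbers: partial sums of i.i.d.
  integrable variables with negative mean are almost surely bounded above. For continuity, the
  finitely many atoms of maximal mass are mapped into themselves by \<open>x \<mapsto> a (x - b)\<close> almost surely;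
  this map is increasing, so it fixes the largest of them, contradicting nondegeneracy.
\<close>

section \<open>Running maxima of partial sums\<close>

text \<open>The maximum of 0 and the first \<open>n\<close> partial sums. Recursing at the front
  makes prepending a point \<open>x\<close> act as \<open>max 0 (z x + _)\<close>, which fits the
  shift invariance of the product measure.\<close>

primrec running_max :: "('a \<Rightarrow> real) \<Rightarrow> nat \<Rightarrow> (nat \<Rightarrow> 'a) \<Rightarrow> real" where
  "running_max z 0 s = 0"
| "running_max z (Suc n) s = max 0 (z (s 0) + running_max z n (\<lambda>i. s (Suc i)))"

lemma running_max_nonneg: "0 \<le> running_max z n s"
  by (cases n) auto

lemma running_max_mono: "m \<le> n \<Longrightarrow> running_max z m s \<le> running_max z n s"
proof (induction m arbitrary: n s)
  case 0
  then show ?case by (simp add: running_max_nonneg)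
next
  case (Suc m)
  then obtain k where "n = Suc k" "m \<le> k" by (cases n) auto
  then show ?case using Suc.IH[of k "\<lambda>i. s (Suc i)"] by auto
qed

lemma sum_le_running_max: "(\<Sum>i<n. z (s i)) \<le> running_max z n s"
proof (induction n arbitrary: s)
  case (Suc n)
  have "(\<Sum>i<Suc n. z (s i)) = z (s 0) + (\<Sum>i<n. z (s (Suc i)))"
    by (rule sum.lessThan_Suc_shift)
  with Suc[of "\<lambda>i. s (Suc i)"] show ?case by simp
qed simp

lemma (in pair_prob_space) distr_pair_snd: "distr (M1 \<Otimes>\<^sub>M M2) M2 snd = M2"
proof -
  have "distr (M1 \<Otimes>\<^sub>M M2) M2 snd = distr (M2 \<Otimes>\<^sub>M M1) M2 fst"
    by (subst distr_pair_swap) (simp add: distr_distr comp_def case_prod_beta')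
  then show ?thesis by (simp add: M1.distr_pair_fst)
qed

section \<open>Shift invariance and a one-sided law of large numbers\<close>

context sequence_space
begin

lemma measurable_shift [measurable]: "(\<lambda>s i. s (Suc i)) \<in> measurable S S"
  by (rule measurable_PiM_single') (auto simp: space_PiM PiE_iff)

lemma measurable_running_max [measurable]:
  assumes [measurable]: "z \<in> borel_measurable M"
  shows "running_max z n \<in> borel_measurable S"
  by (induction n) (simp_all, measurable)

lemma integral_PiM_iter:
  fixes f :: "(nat \<Rightarrow> 'a) \<Rightarrow> real"
  assumes [measurable]: "f \<in> borel_measurable S"
  shows "integral\<^sup>L S f = (LINT p|(M \<Otimes>\<^sub>M S). f (case_nat (fst p) (snd p)))"
  by (subst PiM_iter[symmetric], subst integral_distr) (auto simp: case_prod_beta')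

lemma integrable_PiM_iter:
  fixes f :: "(nat \<Rightarrow> 'a) \<Rightarrow> real"
  assumes [measurable]: "f \<in> borel_measurable S"
  shows "integrable S f \<longleftrightarrow> integrable (M \<Otimes>\<^sub>M S) (\<lambda>p. f (case_nat (fst p) (snd p)))"
  by (subst PiM_iter[symmetric], subst integrable_distr_eq) (auto simp: case_prod_beta')

text \<open>
  On the shift-invariant event \<open>B\<close> where the running maxima \<open>m\<^sub>n\<close> are unbounded, the increments
  \<open>max 0 (z + m\<^sub>n) - m\<^sub>n = max (- m\<^sub>n) z\<close> have nonnegative mean and tend to \<open>z\<close>. As \<open>z\<close> is
  independent of \<open>B\<close>, its mean times the probability of \<open>B\<close> is nonnegative.
\<close>

lemma AE_bdd_above_partial_sums:
  fixes z :: "'a \<Rightarrow> real"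
  assumes z: "integrable M z" and neg: "integral\<^sup>L M z < 0"
  shows "AE s in S. \<exists>C. \<forall>n. (\<Sum>i<n. z (s i)) \<le> C"
proof -
  interpret Q: pair_prob_space M S ..
  have zm [measurable]: "z \<in> borel_measurable M" using z by simp
  \<comment> \<open>Natural-number thresholds make the event a countable combination, hence
    measurable.\<close>
  define B where "B = {s \<in> space S. \<forall>c::nat. \<exists>n. real c < running_max z n s}"
  have B [measurable]: "B \<in> sets S" unfolding B_def by measurable
  have zint: "integrable (M \<Otimes>\<^sub>M S) (\<lambda>p. z (fst p))"
    using z by (subst integrable_distr_eq[of fst _ M, symmetric]) (simp_all add: P.distr_pair_fst)
  have shift: "integrable (M \<Otimes>\<^sub>M S) (\<lambda>p. f (snd p))" if "integrable S f" for f :: "_ \<Rightarrow> real"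
    by (subst integrable_distr_eq[of snd _ S, symmetric])
      (use that in \<open>simp_all add: Q.distr_pair_snd\<close>)
  have lint: "integrable S (running_max z n)" for n
  proof (induction n)
    case (Suc n)
    show ?case
      by (subst integrable_PiM_iter) (use zint shift[OF Suc] in \<open>auto\<close>)
  qed simp
  \<comment> \<open>Prepending \<open>x\<close> changes the partial sums by the finite amount
    \<open>z x\<close>, which neither creates nor destroys unboundedness.\<close>
  have B_iter: "case_nat x s \<in> B \<longleftrightarrow> s \<in> B" if "x \<in> space M" "s \<in> space S" for x s
  proof
    assume "s \<in> B"
    show "case_nat x s \<in> B"
      unfolding B_def
    proof safe
      show "case_nat x s \<in> space S" using that by (auto simp: space_PiM PiE_iff split: nat.split)
      fix c :: nat
      obtain d :: nat where d: "real c - z x < d" using reals_Archimedean2 by blast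
      from \<open>s \<in> B\<close> obtain n where "d < running_max z n s" by (auto simp: B_def)
      with d show "\<exists>n. real c < running_max z n (case_nat x s)"
        by (intro exI[of _ "Suc n"]) simp
    qed
  next
    assume *: "case_nat x s \<in> B"
    show "s \<in> B"
      unfolding B_def
    proof (safe)
      show "s \<in> space S" by fact
      fix c :: nat
      obtain d :: nat where d: "c + \<bar>z x\<bar> < d" using reals_Archimedean2 by blast
      from * obtain n where n: "d < running_max z n (case_nat x s)" by (auto simp: B_def)
      then obtain k where "n = Suc k" by (cases n) auto
      with n d show "\<exists>n. real c < running_max z n s"
        by (intro exI[of _ k]) (auto simp: max_def split: if_splits)
    qed
  qed
  let ?g = "\<lambda>n p. max (- running_max z n (snd p)) (z (fst p)) * indicator B (snd p)"
  \<comment> \<open>The running maximum is nonnegative, so clipping \<open>z\<close> from below at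
    its negative can only move the value towards 0. The majorant does not depend on
    \<open>n\<close>.\<close>
  have bound: "norm (?g n p) \<le> norm (z (fst p))" for n p
    using running_max_nonneg[of z n "snd p"] by (cases "snd p \<in> B") (simp_all add: max_def)
  have gint: "integrable (M \<Otimes>\<^sub>M S) (?g n)" for n
    by (rule Bochner_Integration.integrable_bound[OF zint], measurable)
      (rule AE_I2, rule bound)
  have step: "0 \<le> integral\<^sup>L (M \<Otimes>\<^sub>M S) (?g n)" for n
  proof -
    have i1: "integrable S (\<lambda>s. running_max z n s * indicator B s)" for n
      using integrable_mult_indicator[OF B lint[of n]] by (simp add: mult.commute)
    \<comment> \<open>The mean of the running maximum over \<open>B\<close> grows with
      \<open>n\<close>. Invariance splits the mean at \<open>Suc n\<close> into that of the
      increment plus the mean at \<open>n\<close>, which is finite and cancels.\<close>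
    have "(LINT s|S. running_max z n s * indicator B s)
        \<le> (LINT s|S. running_max z (Suc n) s * indicator B s)"
      by (intro integral_mono i1 mult_right_mono running_max_mono) auto
    also have "\<dots> = (LINT p|(M \<Otimes>\<^sub>M S).
        max 0 (z (fst p) + running_max z n (snd p)) * indicator B (snd p))"
      by (subst integral_PiM_iter)
        (auto simp: space_pair_measure indicator_def B_iter intro!: Bochner_Integration.integral_cong)
    also have "\<dots> = (LINT p|(M \<Otimes>\<^sub>M S). ?g n p + running_max z n (snd p) * indicator B (snd p))"
      by (intro Bochner_Integration.integral_cong) (auto simp: indicator_def max_def)
    also have "\<dots> = integral\<^sup>L (M \<Otimes>\<^sub>M S) (?g n)
        + (LINT p|(M \<Otimes>\<^sub>M S). running_max z n (snd p) * indicator B (snd p))"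
      by (intro Bochner_Integration.integral_add gint shift[OF i1])
    also have "(LINT p|(M \<Otimes>\<^sub>M S). running_max z n (snd p) * indicator B (snd p))
        = (LINT s|S. running_max z n s * indicator B s)"
      by (subst integral_distr[of snd _ S, symmetric]) (simp_all add: Q.distr_pair_snd)
    finally show ?thesis by simp
  qed
  let ?h = "\<lambda>p. z (fst p) * indicator B (snd p)"
  have hint: "integrable (M \<Otimes>\<^sub>M S) ?h"
    by (intro Bochner_Integration.integrable_bound[OF zint])
      (auto intro!: AE_I2 simp: indicator_def)
  have "(\<lambda>n. integral\<^sup>L (M \<Otimes>\<^sub>M S) (?g n)) \<longlonglongrightarrow> integral\<^sup>L (M \<Otimes>\<^sub>M S) ?h"
  proof (rule integral_dominated_convergence[where w="\<lambda>p. \<bar>z (fst p)\<bar>"])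
    show "AE p in M \<Otimes>\<^sub>M S. (\<lambda>n. ?g n p) \<longlonglongrightarrow> ?h p"
    proof (rule AE_I2)
      fix p
      show "(\<lambda>n. ?g n p) \<longlonglongrightarrow> ?h p"
      proof (cases "snd p \<in> B")
        case True
        obtain c :: nat where c: "- z (fst p) < c" using reals_Archimedean2 by blast
        from True obtain m where m: "c < running_max z m (snd p)" by (auto simp: B_def)
        \<comment> \<open>Once the running maximum exceeds \<open>- z (fst p)\<close>, the clipping
          is inactive, so the sequence is eventually constant.\<close>
        have "?g n p = ?h p" if "m \<le> n" for n
          using running_max_mono[OF that, of z "snd p"] m c by (simp add: max_def)
        then show ?thesis
          by (intro tendsto_eventually eventually_sequentiallyI[of m])
      qed simp
    qed
    show "AE p in M \<Otimes>\<^sub>M S. norm (?g n p) \<le> \<bar>z (fst p)\<bar>" for n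
      by (rule AE_I2) (use bound in simp)
  qed (use zint in simp_all)
  then have "0 \<le> integral\<^sup>L (M \<Otimes>\<^sub>M S) ?h"
    by (rule LIMSEQ_le_const) (use step in blast)
  \<comment> \<open>By Fubini the integral factors: \<open>z\<close> sees only the first point and
    \<open>B\<close> only the others. A negative mean then forces \<open>B\<close> to be
    null.\<close>
  also have "integral\<^sup>L (M \<Otimes>\<^sub>M S) ?h = (LINT x|M. z x * measure S B)"
    by (subst Q.integral_fst'[OF hint, symmetric]) simp
  also have "\<dots> = integral\<^sup>L M z * measure S B" by simp
  finally have "measure S B = 0"
    using neg measure_nonneg[of S B] by (auto simp: zero_le_mult_iff)
  then have "AE s in S. s \<notin> B"
    by (subst AE_iff_measurable[OF B]) (auto simp: P.emeasure_eq_measure B_def)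
  with AE_space show ?thesis
  proof eventually_elim
    case (elim s)
    then obtain c :: nat where "\<And>n. running_max z n s \<le> c" by (auto simp: B_def not_less)
    then show ?case using sum_le_running_max[of z s] order_trans by blast
  qed
qed

end

text \<open>Dominated convergence along integer levels. It serves to choose a truncation level at
  which the mean excess stays below the drift of a walk.\<close>

lemma exists_small_truncated_mean:
  fixes f :: "'a \<Rightarrow> real"
  assumes f: "integrable M f" and "0 < e"
  shows "\<exists>L. (LINT x|M. max (f x - L) 0) < e"
proof -
  have "(\<lambda>n. LINT x|M. max (f x - real n) 0) \<longlonglongrightarrow> (LINT x|M. 0)"
  proof (rule integral_dominated_convergence[where w="\<lambda>x. \<bar>f x\<bar>"])
    show "AE x in M. (\<lambda>n. max (f x - real n) 0) \<longlonglongrightarrow> 0"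
    proof (rule AE_I2)
      fix x
      obtain m :: nat where "f x < m" using reals_Archimedean2 by blast
      then show "(\<lambda>n. max (f x - real n) 0) \<longlonglongrightarrow> 0"
        by (intro tendsto_eventually eventually_sequentiallyI[of m]) (auto simp: max_def)
    qed
  qed (use f in auto)
  then have "\<forall>\<^sub>F n in sequentially. (LINT x|M. max (f x - real n) 0) < e"
    using \<open>0 < e\<close> by (simp add: order_tendsto_iff)
  from eventually_happens[OF this] show ?thesis by auto
qed

section \<open>The series for a fixed sequence of pairs\<close>

text \<open>The series is a function on sequence space, so that its law is an image of the product
  measure. Position \<open>n\<close> holds the pair with number \<open>n + 1\<close>.\<close>

definition perpetuity_term :: "(nat \<Rightarrow> real \<times> real) \<Rightarrow> nat \<Rightarrow> real" where
  "perpetuity_term s n = snd (s n) * inverse (\<Prod>i<n. fst (s i))"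

definition perpetuity :: "(nat \<Rightarrow> real \<times> real) \<Rightarrow> real" where
  "perpetuity s = (\<Sum>n. perpetuity_term s n)"

text \<open>The new first term is \<open>snd p\<close>, and every old term moves up one index and
  gains the factor \<open>inverse (fst p)\<close>.\<close>

lemma perpetuity_case_nat:
  assumes "summable (perpetuity_term s)"
  shows "perpetuity (case_nat p s) = snd p + perpetuity s * inverse (fst p)"
proof -
  have shift: "perpetuity_term (case_nat p s) (Suc n) = perpetuity_term s n * inverse (fst p)" for n
    by (simp add: perpetuity_term_def prod.lessThan_Suc_shift del: prod.lessThan_Suc)
  have "summable (\<lambda>n. perpetuity_term (case_nat p s) (Suc n))"
    unfolding shift using assms by (rule summable_mult2)
  then have "summable (perpetuity_term (case_nat p s))"
    by (simp only: summable_Suc_iff)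
  then have "perpetuity (case_nat p s)
      = perpetuity_term (case_nat p s) 0 + (\<Sum>n. perpetuity_term (case_nat p s) (Suc n))"
    unfolding perpetuity_def by (simp add: suminf_split_head)
  also have "(\<Sum>n. perpetuity_term (case_nat p s) (Suc n)) = perpetuity s * inverse (fst p)"
    unfolding shift perpetuity_def using assms by (rule suminf_mult2[symmetric])
  finally show ?thesis by (simp add: perpetuity_term_def)
qed

text \<open>In logarithmic form, \<open>V\<close> bounds the numerator and the sum of the
  \<open>X\<close> is the denominator. The single bound \<open>C\<close> makes the walk outgrow both
  the linear term \<open>d * n\<close> and the excess of \<open>X + V\<close> over \<open>L\<close>,
  so the terms decay geometrically.\<close>

lemma summable_perpetuity_term:
  fixes s :: "nat \<Rightarrow> real \<times> real" and L d C :: real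
  defines "X \<equiv> \<lambda>p. ln (fst p)" and "V \<equiv> \<lambda>p. ln (max \<bar>snd p\<bar> 1)"
  assumes pos: "\<And>i. 0 < fst (s i)" and "0 < d"
    and bound: "\<And>n. (\<Sum>i<n. max (X (s i) + V (s i) - L) 0 - X (s i) + d) \<le> C"
  shows "summable (perpetuity_term s)"
proof (rule summable_comparison_test)
  let ?m = "\<lambda>i. max (X (s i) + V (s i) - L) 0"
  show "summable (\<lambda>n. exp (L + C) * exp (- d) ^ Suc n)"
    using \<open>0 < d\<close> by (intro summable_mult) (simp add: summable_Suc_iff del: power_Suc)
  show "\<exists>N. \<forall>n\<ge>N. norm (perpetuity_term s n) \<le> exp (L + C) * exp (- d) ^ Suc n"
  proof (intro exI allI impI)
    fix n
    have "inverse (\<Prod>i<n. fst (s i)) = exp (- (\<Sum>i<n. X (s i)))"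
      using pos by (simp add: exp_minus exp_sum X_def)
    moreover have "\<bar>snd (s n)\<bar> \<le> exp (V (s n))" by (simp add: V_def)
    ultimately have "norm (perpetuity_term s n) \<le> exp (V (s n)) * exp (- (\<Sum>i<n. X (s i)))"
      by (simp add: perpetuity_term_def abs_mult)
    \<comment> \<open>Including \<open>X (s n)\<close> on both sides extends the walk to
      \<open>Suc n\<close>, where the bound also contains the excess at index
      \<open>n\<close>.\<close>
    also have "\<dots> = exp (X (s n) + V (s n) - (\<Sum>i<Suc n. X (s i)))"
      by (simp add: exp_add[symmetric])
    also have "\<dots> \<le> exp (L + C - d * Suc n)"
    proof -
      have "X (s n) + V (s n) \<le> L + ?m n" by simp
      \<comment> \<open>All excesses are nonnegative, so one of them is at most their sum.\<close>
      also have "?m n \<le> (\<Sum>i<Suc n. ?m i)" by (simp add: sum_nonneg)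
      also have "\<dots> \<le> C + (\<Sum>i<Suc n. X (s i)) - d * Suc n"
        using bound[of "Suc n"] by (simp only: sum.distrib sum_subtractf) (simp add: algebra_simps)
      finally show ?thesis by simp
    qed
    also have "\<dots> = exp (L + C) * exp (- d) ^ Suc n"
      by (simp add: exp_of_nat_mult[symmetric] exp_add[symmetric] algebra_simps)
    finally show "norm (perpetuity_term s n) \<le> exp (L + C) * exp (- d) ^ Suc n" .
  qed
qed

text \<open>With \<open>q\<close> the mass of \<open>a\<close>, at most \<open>1 / q\<close> points
  have mass at least \<open>q\<close>. The largest mass among these finitely many is attained, and
  no other point can exceed it.\<close>

lemma (in real_distribution) exists_maximal_atoms:
  assumes "measure M {a} \<noteq> 0"
  shows "\<exists>m>0. finite {x. measure M {x} = m} \<and> {x. measure M {x} = m} \<noteq> {} \<and> (\<forall>x. measure M {x} \<le> m)"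
proof -
  let ?q = "measure M {a}"
  have q: "0 < ?q" using assms by (simp add: zero_less_measure_iff)
  define K where "K = {x. ?q \<le> measure M {x}}"
  have "finite K"
  proof (rule ccontr)
    assume "infinite K"
    obtain n :: nat where n: "1 / ?q < n" using reals_Archimedean2 by blast
    obtain F where F: "F \<subseteq> K" "finite F" "card F = n"
      using infinite_arbitrarily_large[OF \<open>infinite K\<close>] by blast
    have "n * ?q \<le> (\<Sum>x\<in>F. measure M {x})"
      using F sum_mono[of F "\<lambda>_. ?q" "\<lambda>x. measure M {x}"] by (auto simp: K_def)
    also have "\<dots> = measure M F"
      using F(2) by (intro finite_measure_eq_sum_singleton[symmetric]) auto
    also have "\<dots> \<le> 1" by simp
    finally show False using n q by (simp add: field_simps)
  qed
  define m where "m = Max ((\<lambda>x. measure M {x}) ` K)"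
  have "a \<in> K" by (simp add: K_def)
  have qm: "?q \<le> m"
    unfolding m_def using \<open>finite K\<close> \<open>a \<in> K\<close> by simp
  have le_m: "measure M {x} \<le> m" for x
  proof (cases "x \<in> K")
    case True
    then show ?thesis unfolding m_def using \<open>finite K\<close> by simp
  next
    case False
    then show ?thesis using qm by (simp add: K_def)
  qed
  have "{x. measure M {x} = m} \<subseteq> K" using qm by (auto simp: K_def)
  then have "finite {x. measure M {x} = m}" using \<open>finite K\<close> finite_subset by blast
  moreover have "m \<in> (\<lambda>x. measure M {x}) ` K"
    unfolding m_def using \<open>finite K\<close> \<open>a \<in> K\<close> by (intro Max_in) auto
  ultimately show ?thesis using le_m less_le_trans[OF q qm] by (intro exI[of _ m]) auto
qed

section \<open>The law of the series under the product measure\<close>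

text \<open>Here \<open>M\<close> is the joint law of the pair on the plane, and positivity lets the
  logarithm be written without absolute value.\<close>

locale perpetuity_law = sequence_space M for M :: "(real \<times> real) measure" +
  assumes sets_M [measurable_cong]: "sets M = sets borel"
    and pos: "AE p in M. 0 < fst p"
    and integrable_ln: "integrable M (\<lambda>p. ln (fst p))"
    and drift: "0 < (LINT p|M. ln (fst p))"
    and integrable_ln_max: "integrable M (\<lambda>p. ln (max \<bar>snd p\<bar> 1))"
    and nondegenerate: "\<not> (AE p in M. fst p * (c - snd p) = c)"
begin

lemma measurable_fst_M [measurable]: "fst \<in> borel_measurable M"
  and measurable_snd_M [measurable]: "snd \<in> borel_measurable M"
  unfolding borel_prod[symmetric] measurable_cong_sets[OF sets_M[unfolded borel_prod[symmetric]] refl]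
  by measurable

lemma measurable_perpetuity_term [measurable]: "(\<lambda>s. perpetuity_term s n) \<in> borel_measurable S"
  unfolding perpetuity_term_def by measurable

lemma measurable_perpetuity [measurable]: "perpetuity \<in> borel_measurable S"
  unfolding perpetuity_def by measurable

lemma AE_summable: "AE s in S. summable (perpetuity_term s)"
proof -
  let ?X = "\<lambda>p. ln (fst p)" and ?V = "\<lambda>p. ln (max \<bar>snd p\<bar> 1)"
  \<comment> \<open>Adding the truncated excess to the walk controls the numerators of the series as well, so no
    separate Borel--Cantelli argument for them is necessary.\<close>
  define d where "d = (LINT p|M. ?X p) / 3"
  have d: "0 < d" using drift by (simp add: d_def)
  obtain L where L: "(LINT p|M. max (?X p + ?V p - L) 0) < d"
    using exists_small_truncated_mean[of M "\<lambda>p. ?X p + ?V p" d] d integrable_ln integrable_ln_max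
    by auto
  let ?z = "\<lambda>p. max (?X p + ?V p - L) 0 - ?X p + d"
  have mint: "integrable M (\<lambda>p. max (?X p + ?V p - L) 0)"
    using integrable_ln integrable_ln_max by simp
  then have "integral\<^sup>L M ?z = (LINT p|M. max (?X p + ?V p - L) 0) - (LINT p|M. ?X p) + d"
    using integrable_ln by (simp add: M.prob_space)
  \<comment> \<open>The drift is \<open>3 * d\<close>, so the mean is below
    \<open>d - 3 * d + d = - d\<close>.\<close>
  also have "\<dots> < 0" using L d by (simp add: d_def)
  finally have "AE s in S. \<exists>C. \<forall>n. (\<Sum>i<n. ?z (s i)) \<le> C"
    using mint integrable_ln by (intro AE_bdd_above_partial_sums) simp_all
  moreover have "AE s in S. \<forall>i. 0 < fst (s i)"
    unfolding AE_all_countable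
    by (intro allI AE_PiM_component[where M="\<lambda>_. M" and P="\<lambda>p. 0 < fst p"] M.prob_space_axioms pos) auto
  ultimately show ?thesis
  proof eventually_elim
    case (elim s)
    then obtain C where "\<And>n. (\<Sum>i<n. ?z (s i)) \<le> C" by blast
    with elim d show ?case by (intro summable_perpetuity_term[of s d L C]) auto
  qed
qed

sublocale law: real_distribution "distr S borel perpetuity"
  by (simp add: real_distribution_def real_distribution_axioms_def P.prob_space_distr)

text \<open>Conditioning on the first pair: \<open>R p\<close> describes the preimage of
  \<open>A\<close> under the affine map that prepends \<open>p\<close>. A general \<open>R\<close>
  covers half-lines, for the distribution function, and singletons, for the atoms.\<close>

lemma prob_perpetuity_iter:
  assumes A [measurable]: "A \<in> sets borel"
    and R [measurable]: "Measurable.pred (M \<Otimes>\<^sub>M borel) (\<lambda>q. R (fst q) (snd q))"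
    and R_iff: "\<And>p y. 0 < fst p \<Longrightarrow> snd p + y * inverse (fst p) \<in> A \<longleftrightarrow> R p y"
  shows "measure (distr S borel perpetuity) A
    = (LINT p|M. measure (distr S borel perpetuity) {y. R p y})"
proof -
  interpret Q: pair_prob_space M S ..
  let ?f = "\<lambda>q. of_bool (R (fst q) (perpetuity (snd q))) :: real"
  have fm [measurable]: "?f \<in> borel_measurable (M \<Otimes>\<^sub>M S)"
  proof -
    have "(\<lambda>q. (fst q, perpetuity (snd q))) \<in> M \<Otimes>\<^sub>M S \<rightarrow>\<^sub>M M \<Otimes>\<^sub>M borel" by measurable
    from measurable_compose[OF this R]
    have [measurable]: "Measurable.pred (M \<Otimes>\<^sub>M S) (\<lambda>q. R (fst q) (perpetuity (snd q)))" by simp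
    show ?thesis by measurable
  qed
  have f: "integrable (M \<Otimes>\<^sub>M S) ?f"
    by (rule Q.P.integrable_const_bound[where B=1]) (auto simp: fm)
  have "AE q in M \<Otimes>\<^sub>M S. summable (perpetuity_term (snd q))"
    by (rule AE_distrD[OF measurable_snd]) (use AE_summable in \<open>simp only: Q.distr_pair_snd\<close>)
  moreover have "AE q in M \<Otimes>\<^sub>M S. 0 < fst (fst q)"
    by (rule AE_distrD[OF measurable_fst]) (use pos in \<open>simp only: P.distr_pair_fst\<close>)
  \<comment> \<open>The recursion needs convergence of the tail series, and \<open>R_iff\<close>
    needs a positive first factor; both hold almost everywhere.\<close>
  ultimately have ae: "AE q in M \<Otimes>\<^sub>M S.
      indicator A (perpetuity (case_nat (fst q) (snd q))) = ?f q"
    by eventually_elim (simp add: perpetuity_case_nat R_iff indicator_def)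
  have "measure (distr S borel perpetuity) A = (LINT s|S. indicator A (perpetuity s))"
    by (subst integral_distr[symmetric, where N=borel]) simp_all
  also have "\<dots> = (LINT q|(M \<Otimes>\<^sub>M S). indicator A (perpetuity (case_nat (fst q) (snd q))))"
    by (rule integral_PiM_iter) measurable
  also have "\<dots> = integral\<^sup>L (M \<Otimes>\<^sub>M S) ?f"
    by (rule integral_cong_AE[OF _ fm ae]) measurable
  also have "\<dots> = (LINT p|M. LINT s|S. ?f (p, s))"
    by (rule Q.integral_fst'[OF f, symmetric])
  also have "\<dots> = (LINT p|M. measure (distr S borel perpetuity) {y. R p y})"
  proof (rule Bochner_Integration.integral_cong[OF refl])
    fix p assume p: "p \<in> space M"
    have "(\<lambda>y. (p, y)) \<in> borel \<rightarrow>\<^sub>M M \<Otimes>\<^sub>M borel" using p by measurable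
    from measurable_compose[OF this R]
    have [measurable]: "Measurable.pred borel (R p)" by simp
    have "(LINT s|S. ?f (p, s)) = (LINT s|S. indicator {y. R p y} (perpetuity s))"
      by (simp add: indicator_def of_bool_def)
    also have "\<dots> = (LINT y|distr S borel perpetuity. indicator {y. R p y} y)"
      by (subst integral_distr[where N=borel]) simp_all
    finally show "(LINT s|S. ?f (p, s)) = measure (distr S borel perpetuity) {y. R p y}"
      by simp
  qed
  finally show ?thesis .
qed

lemma cdf_perpetuity_eq:
  "cdf (distr S borel perpetuity) x
    = (LINT p|M. cdf (distr S borel perpetuity) (fst p * (x - snd p)))"
proof -
  have R: "Measurable.pred (M \<Otimes>\<^sub>M borel) (\<lambda>q. snd q \<le> fst (fst q) * (x - snd (fst q)))"
    unfolding pred_def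
    by (intro borel_measurable_le borel_measurable_times borel_measurable_diff
        borel_measurable_const measurable_snd
        measurable_compose[OF measurable_fst measurable_fst_M]
        measurable_compose[OF measurable_fst measurable_snd_M])
  have iff: "snd p + y * inverse (fst p) \<in> {..x} \<longleftrightarrow> y \<le> fst p * (x - snd p)"
    if "0 < fst p" for p :: "real \<times> real" and y
    using that by (auto simp: divide_simps algebra_simps)
  show ?thesis
    using prob_perpetuity_iter[where A="{..x}" and R="\<lambda>p y. y \<le> fst p * (x - snd p)", OF _ R iff]
    by (simp add: cdf_def atMost_def)
qed

text \<open>Each point mass is an average of the masses at the random images of the point; a maximum
  principle for atoms follows.\<close>

lemma atom_perpetuity_eq:
  "measure (distr S borel perpetuity) {x}
    = (LINT p|M. measure (distr S borel perpetuity) {fst p * (x - snd p)})"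
proof -
  have R: "Measurable.pred (M \<Otimes>\<^sub>M borel) (\<lambda>q. snd q = fst (fst q) * (x - snd (fst q)))"
    unfolding pred_def
    by (intro borel_measurable_eq borel_measurable_times borel_measurable_diff
        borel_measurable_const measurable_snd
        measurable_compose[OF measurable_fst measurable_fst_M]
        measurable_compose[OF measurable_fst measurable_snd_M])
  have iff: "snd p + y * inverse (fst p) \<in> {x} \<longleftrightarrow> y = fst p * (x - snd p)"
    if "0 < fst p" for p :: "real \<times> real" and y
    using that by (auto simp: divide_simps algebra_simps)
  show ?thesis
    using prob_perpetuity_iter[where A="{x}" and R="\<lambda>p y. y = fst p * (x - snd p)", OF _ R iff]
    by simp
qed

lemma no_atoms: "measure (distr S borel perpetuity) {x} = 0"
proof (rule ccontr)
  assume "measure (distr S borel perpetuity) {x} \<noteq> 0"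
  then obtain m where m_pos: "0 < m"
    and fin: "finite {x. measure (distr S borel perpetuity) {x} = m}"
    and ne: "{x. measure (distr S borel perpetuity) {x} = m} \<noteq> {}"
    and le_m: "\<And>x. measure (distr S borel perpetuity) {x} \<le> m"
    using law.exists_maximal_atoms by blast
  define E where "E = {x. measure (distr S borel perpetuity) {x} = m}"
  note E = m_pos fin[folded E_def] ne[folded E_def] E_def
  \<comment> \<open>The maximal mass \<open>m\<close> is the mean of masses that never exceed
    \<open>m\<close>, so almost all of them equal \<open>m\<close>.\<close>
  have "AE p in M. fst p * (x - snd p) \<in> E" if "x \<in> E" for x
  proof -
    let ?g = "\<lambda>p. measure (distr S borel perpetuity) {fst p * (x - snd p)}"
    have m: "(LINT p|M. ?g p) = m"
      using that E(4) atom_perpetuity_eq[of x] by simp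
    \<comment> \<open>A non-integrable function would have integral \<open>0\<close>, whereas \<open>m > 0\<close>.\<close>
    have g: "integrable M ?g"
      using not_integrable_integral_eq[of M ?g] m E(1) by linarith
    have "(LINT p|M. m - ?g p) = 0"
      using g m by (simp add: M.prob_space)
    then have "AE p in M. m - ?g p = 0"
      using integral_nonneg_eq_0_iff_AE[of M "\<lambda>p. m - ?g p"] g le_m by simp
    then show ?thesis by eventually_elim (simp add: E(4))
  qed
  \<comment> \<open>Finiteness of \<open>E\<close> allows one common null set for all its
    points.\<close>
  then have "AE p in M. \<forall>x\<in>E. fst p * (x - snd p) \<in> E"
    using E(2) by (intro AE_finite_allI)
  with pos have "AE p in M. fst p * (Max E - snd p) = Max E"
  proof eventually_elim
    case (elim p)
    let ?T = "\<lambda>x. fst p * (x - snd p)"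
    \<comment> \<open>An injective self-map of a finite set is onto, so \<open>Max E\<close> is the
      image of some \<open>y\<close>. Monotonicity squeezes \<open>?T (Max E)\<close> between
      \<open>?T y = Max E\<close> and \<open>Max E\<close>.\<close>
    have "inj_on ?T E" using elim by (auto simp: inj_on_def)
    then have "?T ` E = E" using elim E(2) by (intro card_subset_eq) (auto simp: card_image)
    then obtain y where y: "y \<in> E" "?T y = Max E" using Max_in[OF E(2,3)] by force
    have "?T y \<le> ?T (Max E)" using y(1) E(2) elim by (intro mult_left_mono) auto
    moreover have "?T (Max E) \<le> Max E" using elim E(2,3) by simp
    ultimately show ?case using y(2) by simp
  qed
  then show False using nondegenerate by blast
qed

lemma isCont_cdf_perpetuity: "isCont (cdf (distr S borel perpetuity)) x"
  by (simp add: law.isCont_cdf no_atoms)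

end

section \<open>Transfer to the given i.i.d. sequence\<close>

text \<open>Independence and equal marginals make the joint law over the indices from 1 on a product
  measure; reindexing along \<open>Suc\<close> moves it to all naturals.\<close>

lemma iid_copies_joint_distr:
  fixes M :: "'a measure" and N :: "'b measure"
  assumes M: "prob_space M" and [measurable]: "\<alpha> \<in> borel_measurable M" "\<beta> \<in> borel_measurable M"
    and N: "prob_space N" and iid: "iid_copies M \<alpha> \<beta> N \<alpha>s \<beta>s"
  defines "\<mu> \<equiv> distr M borel (\<lambda>\<omega>. (\<alpha> \<omega>, \<beta> \<omega>))"
    and "X \<equiv> \<lambda>\<omega> n. (\<alpha>s (Suc n) \<omega>, \<beta>s (Suc n) \<omega>)"
  shows "X \<in> N \<rightarrow>\<^sub>M (\<Pi>\<^sub>M i\<in>UNIV. \<mu>)"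
    and "distr N (\<Pi>\<^sub>M i\<in>UNIV. \<mu>) X = (\<Pi>\<^sub>M i\<in>UNIV. \<mu>)"
proof -
  interpret M: prob_space M by fact
  interpret N: prob_space N by fact
  have \<mu>: "prob_space \<mu>" unfolding \<mu>_def by (rule M.prob_space_distr) measurable
  have sets_\<mu> [measurable_cong]: "sets \<mu> = sets borel" by (simp add: \<mu>_def)
  let ?Y = "\<lambda>n \<omega>. (\<alpha>s n \<omega>, \<beta>s n \<omega>)"
  let ?K = "\<Pi>\<^sub>M i\<in>{1..}. \<mu>" and ?S = "\<Pi>\<^sub>M i\<in>(UNIV :: nat set). \<mu>"
  have indep: "N.indep_vars (\<lambda>_. borel) ?Y {1..}"
    and law: "distr N borel (?Y n) = \<mu>" if "1 \<le> n" for n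
    using iid that by (auto simp: iid_copies_def \<mu>_def)
  have Y: "?Y n \<in> borel_measurable N" if "1 \<le> n" for n
    using indep[OF that] that by (auto simp: N.indep_vars_def)
  have Y\<mu>: "?Y n \<in> N \<rightarrow>\<^sub>M \<mu>" if "1 \<le> n" for n
    using Y[OF that] measurable_cong_sets[OF refl sets_\<mu>, of N] by simp
  show X: "X \<in> N \<rightarrow>\<^sub>M ?S"
    unfolding X_def
    by (rule measurable_PiM_single') (use Y\<mu> in \<open>auto simp: space_PiM \<mu>_def\<close>)
  \<comment> \<open>The independence criterion has \<open>borel\<close> in each coordinate while
    \<open>?K\<close> carries \<open>\<mu>\<close>; the sigma-algebras agree.\<close>
  have sets_K: "sets (\<Pi>\<^sub>M i\<in>{1..}. borel) = sets ?K"
    by (intro sets_PiM_cong) (simp_all add: sets_\<mu>)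
  have "distr N ?K (\<lambda>\<omega>. \<lambda>n\<in>{1..}. ?Y n \<omega>) = distr N (\<Pi>\<^sub>M i\<in>{1..}. borel) (\<lambda>\<omega>. \<lambda>n\<in>{1..}. ?Y n \<omega>)"
    by (intro distr_cong refl) (rule sets_K[symmetric])
  also have "\<dots> = (\<Pi>\<^sub>M i\<in>{1..}. distr N borel (?Y i))"
    using indep[of 1] by (subst N.indep_vars_iff_distr_eq_PiM'[symmetric]) (auto intro: Y)
  also have "\<dots> = ?K"
    by (intro PiM_cong) (simp_all add: law)
  finally have K: "distr N ?K (\<lambda>\<omega>. \<lambda>n\<in>{1..}. ?Y n \<omega>) = ?K" .
  have "?S = distr ?K ?S (\<lambda>\<omega>. \<lambda>n\<in>UNIV. \<omega> (Suc n))"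
    by (rule distr_PiM_reindex[symmetric, where M="\<lambda>_. \<mu>"]) (auto simp: \<mu>)
  also have "\<dots> = distr (distr N ?K (\<lambda>\<omega>. \<lambda>n\<in>{1..}. ?Y n \<omega>)) ?S (\<lambda>\<omega>. \<lambda>n\<in>UNIV. \<omega> (Suc n))"
    by (simp only: K)
  also have "\<dots> = distr N ?S X"
  proof (subst distr_distr)
    show "(\<lambda>\<omega>. \<lambda>n\<in>UNIV. \<omega> (Suc n)) \<in> ?K \<rightarrow>\<^sub>M ?S"
      by (intro measurable_restrict measurable_component_singleton) simp
    show "(\<lambda>\<omega>. \<lambda>n\<in>{1..}. ?Y n \<omega>) \<in> N \<rightarrow>\<^sub>M ?K"
      by (intro measurable_restrict Y\<mu>) simp
  qed (simp add: comp_def X_def restrict_UNIV)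
  finally show "distr N ?S X = ?S" by (rule sym)
qed

text \<open>This holds at every point, even where the series diverges, since both sides apply
  \<open>suminf\<close> to the same sequence.\<close>

lemma Upsilon_eq_perpetuity:
  "Upsilon \<alpha>s \<beta>s \<omega> = perpetuity (\<lambda>n. (\<alpha>s (Suc n) \<omega>, \<beta>s (Suc n) \<omega>))"
  by (simp add: Upsilon_def perpetuity_def perpetuity_term_def A_prod_def prod.atLeast1_atMost_eq)

theorem theorem3p3:
  fixes M :: "'a measure" and \<alpha> \<beta> :: "'a \<Rightarrow> real"
    and N :: "'b measure" and \<alpha>s \<beta>s :: "nat \<Rightarrow> 'b \<Rightarrow> real"
  assumes "prob_space M"
    and "\<alpha> \<in> borel_measurable M" and "\<beta> \<in> borel_measurable M"
    and "prob_space N"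
    and "iid_copies M \<alpha> \<beta> N \<alpha>s \<beta>s"
    and "\<P>(\<omega> in M. \<alpha> \<omega> \<noteq> 0) = 1"
    and "\<P>(\<omega> in M. \<bar>\<alpha> \<omega>\<bar> \<noteq> 1) > 0"
    and "\<And>c::real. \<P>(\<omega> in M. \<alpha> \<omega> * (c - \<beta> \<omega>) = c) < 1"
    and "integrable M (\<lambda>\<omega>. ln \<bar>\<alpha> \<omega>\<bar>)" and "0 < (LINT \<omega>|M. ln \<bar>\<alpha> \<omega>\<bar>)"
    and "integrable M (\<lambda>\<omega>. ln (max \<bar>\<beta> \<omega>\<bar> 1))"
    and "AE \<omega> in M. \<alpha> \<omega> > 0"
  shows "bounded (range (F_Upsilon N \<alpha>s \<beta>s)) \<and>
         continuous_on UNIV (F_Upsilon N \<alpha>s \<beta>s) \<and>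
         solves_equation M \<alpha> \<beta> (F_Upsilon N \<alpha>s \<beta>s)"
proof -
  interpret M: prob_space M by fact
  note [measurable] = assms(2,3)
  define \<mu> where "\<mu> = distr M borel (\<lambda>\<omega>. (\<alpha> \<omega>, \<beta> \<omega>))"
  have pair [measurable]: "(\<lambda>\<omega>. (\<alpha> \<omega>, \<beta> \<omega>)) \<in> borel_measurable M" by measurable
  have ln_meas: "(\<lambda>p. ln (fst p)) \<in> borel_measurable (borel :: (real \<times> real) measure)"
    and ln_max_meas: "(\<lambda>p. ln (max \<bar>snd p\<bar> 1)) \<in> borel_measurable (borel :: (real \<times> real) measure)"
    by (simp_all add: borel_prod[symmetric])
  \<comment> \<open>Positivity removes the absolute value, so the logarithmic moment assumptions
    pass to \<open>\<mu>\<close>.\<close>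
  have abs_ln: "AE \<omega> in M. ln \<bar>\<alpha> \<omega>\<bar> = ln (\<alpha> \<omega>)"
    using assms(12) by eventually_elim simp
  have \<mu>: "prob_space \<mu>" unfolding \<mu>_def by (rule M.prob_space_distr) fact
  then interpret \<mu>: prob_space \<mu> .
  interpret seq: sequence_space \<mu> ..
  interpret law: perpetuity_law \<mu>
  proof
    show "sets \<mu> = sets borel" by (simp add: \<mu>_def)
    show "AE p in \<mu>. 0 < fst p"
      unfolding \<mu>_def using assms(12) by (subst AE_distr_iff) (auto simp: borel_prod[symmetric])
    show "integrable \<mu> (\<lambda>p. ln (fst p))"
      unfolding \<mu>_def integrable_distr_eq[OF pair ln_meas]
      using assms(9) abs_ln by (subst integrable_cong_AE[symmetric]) auto
    have "(LINT p|\<mu>. ln (fst p)) = (LINT \<omega>|M. ln \<bar>\<alpha> \<omega>\<bar>)"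
      unfolding \<mu>_def integral_distr[OF pair ln_meas]
      using abs_ln by (intro integral_cong_AE) auto
    then show "0 < (LINT p|\<mu>. ln (fst p))" using assms(10) by simp
    show "integrable \<mu> (\<lambda>p. ln (max \<bar>snd p\<bar> 1))"
      unfolding \<mu>_def integrable_distr_eq[OF pair ln_max_meas] using assms(11) by simp
    show "\<not> (AE p in \<mu>. fst p * (c - snd p) = c)" for c
    proof
      assume "AE p in \<mu>. fst p * (c - snd p) = c"
      then have "AE \<omega> in M. \<alpha> \<omega> * (c - \<beta> \<omega>) = c"
        using AE_distrD[OF pair, folded \<mu>_def, of "\<lambda>p. fst p * (c - snd p) = c"] by simp
      then have "\<P>(\<omega> in M. \<alpha> \<omega> * (c - \<beta> \<omega>) = c) = 1"
        by (subst M.prob_Collect_eq_1) simp_all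
      then show False using assms(8)[of c] by simp
    qed
  qed
  let ?S = "\<Pi>\<^sub>M i\<in>(UNIV :: nat set). \<mu>"
  let ?G = "cdf (distr ?S borel perpetuity)"
  let ?X = "\<lambda>\<omega> n. (\<alpha>s (Suc n) \<omega>, \<beta>s (Suc n) \<omega>)"
  note joint = iid_copies_joint_distr[OF assms(1-5), folded \<mu>_def]
  have G: "F_Upsilon N \<alpha>s \<beta>s x = ?G x" for x
  proof -
    have "?G x = measure (distr (distr N ?S ?X) borel perpetuity) {..x}"
      by (simp add: cdf_def joint(2))
    also have "\<dots> = measure N ((\<lambda>\<omega>. perpetuity (?X \<omega>)) -` {..x} \<inter> space N)"
      by (simp add: distr_distr joint(1) measure_distr measurable_compose[OF joint(1)] comp_def)
    finally show ?thesis
      by (simp add: F_Upsilon_def Upsilon_eq_perpetuity vimage_def Int_def conj_commute)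
  qed
  have cont: "continuous_on UNIV ?G"
    by (intro continuous_at_imp_continuous_on ballI law.isCont_cdf_perpetuity)
  \<comment> \<open>This bound gives both the boundedness of the solution and the integrability
    required by \<open>solves_equation\<close>.\<close>
  have bounds: "norm (?G x) \<le> 1" for x
    by (simp add: law.law.cdf_nonneg law.law.cdf_bounded_prob)
  have G_meas [measurable]: "?G \<in> borel_measurable borel"
    using cont by (rule borel_measurable_continuous_onI)
  have "integrable M (\<lambda>\<omega>. ?G (\<alpha> \<omega> * (x - \<beta> \<omega>)))" for x
    using bounds by (intro M.integrable_const_bound[where B=1]) auto
  moreover have "?G x = (LINT \<omega>|M. ?G (\<alpha> \<omega> * (x - \<beta> \<omega>)))" for x
  proof -
    have "(\<lambda>p. ?G (fst p * (x - snd p))) \<in> borel_measurable borel"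
      unfolding borel_prod[symmetric] by measurable
    then have "(LINT p|\<mu>. ?G (fst p * (x - snd p))) = (LINT \<omega>|M. ?G (\<alpha> \<omega> * (x - \<beta> \<omega>)))"
      unfolding \<mu>_def by (subst integral_distr[OF pair]) simp_all
    then show ?thesis using law.cdf_perpetuity_eq[of x] by simp
  qed
  moreover have "bounded (range ?G)"
    using bounds by (auto simp: bounded_iff)
  moreover have F: "F_Upsilon N \<alpha>s \<beta>s = ?G" using G by (rule ext)
  ultimately show ?thesis
    unfolding F solves_equation_def by (intro conjI allI cont)
qed

end
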